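(* Let $V$ be a vertex operator algebra of CFT type. If $V$ is $C_2$-cofinite and $W$ is an irreducible weak $V$-module, then $W$ is $C_2$-cofinite.
   Context: A vertex operator algebra $(V,Y,\mathbf 1,\omega)$ over $\mathbb C$ has grading $V=\bigoplus_{n}V_n$ by $L(0)$-eigenvalues (with $\dim V_n<\infty$), where $Y(\omega,z)=\sum_n L(n)z^{-n-2}$; write $Y(v,z)=\sum_{n\in\mathbb Z}v_nz^{-n-1}$. $V$ is of CFT type if $V=\bigoplus_{n\ge 0}V_n$ and $V_0=\mathbb C\mathbf 1$. Weak $V$-module: a vector space $M$ with a linear map $v\mapsto Y_M(v,z)=\sum_{n\in\mathbb Z}v_nz^{-n-1}$, $v_n\in\mathrm{End}(M)$, such that (1) for $v\in V$, $w\in M$, $v_nw=0$ for $n\gg0$; (2) $Y_M(\mathbf 1,z)=\mathrm{Id}_M$; (3) the Jacobi identity holds: $z_0^{-1}\delta(\frac{z_1-z_2}{z_0})Y_M(u,z_1)Y_M(v,z_2)-z_0^{-1}\delta(\frac{z_2-z_1}{-z_0})Y_M(v,z_2)Y_M(u,z_1)=z_2^{-1}\delta(\frac{z_1-z_0}{z_2})Y_M(Y(u,z_0)v,z_2)$. No grading is assumed. For a weak $V$-module $W$, $C_2(W)$ is the linear span of $\{u_{-2}w\mid u\in V,\ w\in W\}$, and $W$ is called $C_2$-cofinite if $\dim W/C_2(W)<\infty$. $V$ is $C_2$-cofinite if $\dim V/C_2(V)<\infty$, where $C_2(V)$ is the linear span of $\{v_{-2}w\mid v,w\in V\}$. *)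

theory Defs
  imports Complex_Main "HOL-Library.Groups_Big_Fun"
begin

text \<open>Vector spaces are whole types with an explicit scalar multiplication, as in
  \<^locale>\<open>vector_space\<close>. A subspace is finite-dimensional if it has a finite spanning set; the
  library function \<^const>\<open>vector_space.dim\<close> is not used because it is \<open>0\<close> on
  infinite-dimensional spaces.\<close>

definition finite_dim :: "(complex \<Rightarrow> 'a::ab_group_add \<Rightarrow> 'a) \<Rightarrow> 'a set \<Rightarrow> bool" where
  "finite_dim scale U \<longleftrightarrow> (\<exists>B. finite B \<and> module.span scale B = U)"

definition coset :: "'a::ab_group_add set \<Rightarrow> 'a \<Rightarrow> 'a set" where
  "coset U x = {x + u | u. u \<in> U}"

text \<open>For a subspace \<open>U\<close>, the map \<open>coset U\<close> is the linear projection onto the quotient by \<open>U\<close>, so the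
  image of \<open>span B\<close> is the span of the classes of the elements of \<open>B\<close>.\<close>

definition finite_dim_quotient :: "(complex \<Rightarrow> 'a::ab_group_add \<Rightarrow> 'a) \<Rightarrow> 'a set \<Rightarrow> bool" where
  "finite_dim_quotient scale U \<longleftrightarrow>
     (\<exists>B. finite B \<and> coset U ` module.span scale B = range (coset U))"

definition direct_sum_decomposition ::
  "(complex \<Rightarrow> 'a::ab_group_add \<Rightarrow> 'a) \<Rightarrow> 'i set \<Rightarrow> ('i \<Rightarrow> 'a set) \<Rightarrow> bool" where
  "direct_sum_decomposition scale I A \<longleftrightarrow>
     (\<forall>i\<in>I. module.subspace scale (A i)) \<and>
     (\<forall>x. \<exists>!f. (\<forall>i\<in>I. f i \<in> A i) \<and> (\<forall>i. i \<notin> I \<longrightarrow> f i = 0) \<and>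
               finite {i. f i \<noteq> 0} \<and> x = Sum_any f)"

text \<open>\<open>Y v n\<close> and \<open>YW v n\<close> are the modes \<open>v\<^sub>n\<close> of \<open>v\<close> on \<open>V\<close> and on \<open>W\<close>. The locale uses of \<open>V\<close>
  only its vector space structure, \<open>Y\<close> and the vacuum vector, so that the vertex algebra axioms can
  be expressed by taking \<open>W = V\<close>.

  The Jacobi identity is stated as the equality of the coefficients of
  \<open>z\<^sub>0\<close>, \<open>z\<^sub>1\<close>, \<open>z\<^sub>2\<close> to the powers \<open>-l-1\<close>, \<open>-m-1\<close>, \<open>-n-1\<close>, where in each delta function the binomial
  powers are expanded in nonnegative powers of the second variable. On the right-hand side this
  gives the coefficient \<open>(-1)^i * (i - m - 1 gchoose i)\<close>, which is \<open>m gchoose i\<close>. By truncation all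
  three sums have finite support, and \<^const>\<open>Sum_any\<close> is the sum over the support.\<close>

locale weak_module =
  V: vector_space scaleV + W: vector_space scaleW
  for scaleV :: "complex \<Rightarrow> 'v::ab_group_add \<Rightarrow> 'v"
    and scaleW :: "complex \<Rightarrow> 'w::ab_group_add \<Rightarrow> 'w" +
  fixes Y :: "'v \<Rightarrow> int \<Rightarrow> 'v \<Rightarrow> 'v"
    and vac :: 'v
    and YW :: "'v \<Rightarrow> int \<Rightarrow> 'w \<Rightarrow> 'w"
  assumes linear_state: "Vector_Spaces.linear scaleV scaleW (\<lambda>v. YW v n w)"
    and linear_mode: "Vector_Spaces.linear scaleW scaleW (YW v n)"
    and truncation: "\<exists>N. \<forall>n\<ge>N. YW v n w = 0"
    and vacuum: "YW vac n w = (if n = -1 then w else 0)"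
    and jacobi:
      "Sum_any (\<lambda>i::nat. scaleW ((-1) ^ i * (of_int l gchoose i))
          (YW u (m + l - int i) (YW v (n + int i) w)))
       - Sum_any (\<lambda>i::nat. scaleW ((-1) powi l * (-1) ^ i * (of_int l gchoose i))
          (YW v (n + l - int i) (YW u (m + int i) w)))
       = Sum_any (\<lambda>i::nat. scaleW (of_int m gchoose i)
          (YW (Y u (l + int i) v) (m + n - int i) w))"

text \<open>The Virasoro operators are the modes \<open>L(n) = \<omega>\<^bsub>n+1\<^esub>\<close>; in particular \<open>L(0) = \<omega>\<^sub>1\<close> and
  \<open>L(-1) = \<omega>\<^sub>0\<close>. The axiom \<open>translation\<close> below is \<open>Y(L(-1)v, z) = d/dz Y(v, z)\<close>.\<close>

definition weight_space ::
  "(complex \<Rightarrow> 'v::ab_group_add \<Rightarrow> 'v) \<Rightarrow> ('v \<Rightarrow> int \<Rightarrow> 'v \<Rightarrow> 'v) \<Rightarrow> 'v \<Rightarrow> int \<Rightarrow> 'v set" where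
  "weight_space scale Y \<omega> n = {v. Y \<omega> 1 v = scale (of_int n) v}"

locale vertex_operator_algebra =
  weak_module scale scale Y vac Y
  for scale :: "complex \<Rightarrow> 'v::ab_group_add \<Rightarrow> 'v"
    and Y :: "'v \<Rightarrow> int \<Rightarrow> 'v \<Rightarrow> 'v"
    and vac :: 'v +
  fixes \<omega> :: 'v
  assumes creation: "n \<ge> 0 \<Longrightarrow> Y v n vac = 0" "Y v (-1) vac = v"
    and virasoro:
      "\<exists>c. \<forall>m n v.
         Y \<omega> (m + 1) (Y \<omega> (n + 1) v) - Y \<omega> (n + 1) (Y \<omega> (m + 1) v) =
         scale (of_int (m - n)) (Y \<omega> (m + n + 1) v) +
         (if m + n = 0 then scale (of_int (m ^ 3 - m) / 12 * c) v else 0)"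
    and translation: "Y (Y \<omega> 0 v) n w = scale (- of_int n) (Y v (n - 1) w)"
    and grading: "direct_sum_decomposition scale UNIV (weight_space scale Y \<omega>)"
    and grading_finite_dim: "finite_dim scale (weight_space scale Y \<omega> n)"
    and grading_bounded_below: "\<exists>N. \<forall>n<N. weight_space scale Y \<omega> n = {0}"

locale cft_type_voa = vertex_operator_algebra scale Y vac \<omega>
  for scale :: "complex \<Rightarrow> 'v::ab_group_add \<Rightarrow> 'v" and Y vac \<omega> +
  assumes nonneg_grading: "direct_sum_decomposition scale {0..} (weight_space scale Y \<omega>)"
    and weight_zero: "weight_space scale Y \<omega> 0 = V.span {vac}"

locale irreducible_weak_module = weak_module scaleV scaleW Y vac YW
  for scaleV :: "complex \<Rightarrow> 'v::ab_group_add \<Rightarrow> 'v"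
    and scaleW :: "complex \<Rightarrow> 'w::ab_group_add \<Rightarrow> 'w"
    and Y vac YW +
  assumes nontrivial: "(UNIV :: 'w set) \<noteq> {0}"
    and irreducible: "W.subspace U \<Longrightarrow> (\<And>v n w. w \<in> U \<Longrightarrow> YW v n w \<in> U) \<Longrightarrow>
      U = {0} \<or> U = UNIV"

text \<open>The following apply both to \<open>V\<close> (with \<open>YW = Y\<close>) and to weak \<open>V\<close>-modules.\<close>

definition C2 :: "(complex \<Rightarrow> 'w::ab_group_add \<Rightarrow> 'w) \<Rightarrow> ('v \<Rightarrow> int \<Rightarrow> 'w \<Rightarrow> 'w) \<Rightarrow> 'w set" where
  "C2 scaleW YW = module.span scaleW {YW u (-2) w | u w. True}"

definition C2_cofinite ::
  "(complex \<Rightarrow> 'w::ab_group_add \<Rightarrow> 'w) \<Rightarrow> ('v \<Rightarrow> int \<Rightarrow> 'w \<Rightarrow> 'w) \<Rightarrow> bool" where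
  "C2_cofinite scaleW YW \<longleftrightarrow> finite_dim_quotient scaleW (C2 scaleW YW)"

end

theory Submission
  imports Defs "HOL-Library.Multiset"
begin

text \<open>Let \<open>W\<close> be generated by a vector \<open>w\<close>, and filter \<open>W\<close> by the total weight of words
  \<open>u\<^sup>1\<^bsub>n(1)\<^esub> \<dots> u\<^sup>k\<^bsub>n(k)\<^esub> w\<close> in modes of homogeneous vectors. Modulo words of smaller total weight all
  modes commute, so a word with a mode index at most \<open>-2\<close> may be ignored modulo \<open>C\<^sub>2(W)\<close>, and a word
  with a mode that annihilates \<open>w\<close> may be ignored as well. As \<open>V\<close> is \<open>C\<^sub>2\<close>-cofinite, \<open>V\<^sub>d \<subseteq> C\<^sub>2(V)\<close> for
  all \<open>d \<ge> K\<close>; since \<open>a\<^bsub>-2\<^esub>b\<close> has weight one more than \<open>a\<close> and \<open>b\<close> together, a letter of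
  weight at least \<open>K\<close> can be replaced by pairs of letters of smaller total weight. Apply this to
  \<open>u = a\<^sup>1\<^bsub>-1\<^esub> \<dots> a\<^sup>K\<^bsub>-1\<^esub> 1\<close>: the suitable mode of \<open>u\<close>, expanded in modes of the \<open>a\<^sup>i\<close>, rewrites the
  product \<open>a\<^sup>1\<^sub>s \<dots> a\<^sup>K\<^sub>s\<close> in terms of products that contain an index below \<open>s\<close>. By induction on \<open>s\<close>,
  words with many indices at most \<open>s\<close> vanish modulo \<open>C\<^sub>2(W)\<close> and smaller words. What remains is words of
  bounded length, with letters of bounded weight and indices in a bounded interval.\<close>

section \<open>Subspaces, spans and sums of finite support\<close>

context module
begin

lemma subspace_Sum_any:
  assumes "subspace S" "\<And>i. f i \<in> S"
  shows "Sum_any f \<in> S"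
  using assms by (simp add: Sum_any.expand_set subspace_sum)

lemma subspace_Sum_any_diff:
  assumes "subspace S" "finite {i. f i \<noteq> 0}" "\<And>i. i \<noteq> k \<Longrightarrow> f i \<in> S"
  shows "Sum_any f - f k \<in> S"
proof -
  have "Sum_any f = sum f (insert k {i. f i \<noteq> 0})"
    using assms(2) by (intro Sum_any.expand_superset) auto
  also have "\<dots> = f k + sum f ({i. f i \<noteq> 0} - {k})"
    using assms(2) by (simp add: sum.insert_remove)
  finally show ?thesis
    using assms by (auto intro!: subspace_sum)
qed

lemma span_minimalI:
  assumes "x \<in> span A" "subspace S" "\<And>a. a \<in> A \<Longrightarrow> a \<in> S"
  shows "x \<in> S"
  using span_minimal[of A S] assms by blast

lemma subspace_diff_mem:
  assumes "subspace S" "x - y \<in> S"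
  shows "x \<in> S \<longleftrightarrow> y \<in> S"
  using assms by (metis add_diff_cancel_left' diff_add_cancel subspace_add subspace_diff)

lemma span_Un_obtain:
  assumes "x \<in> span (A \<union> B)"
  obtains a b where "a \<in> span A" "b \<in> span B" "x = a + b"
  using assms by (auto simp: span_Un)

end

lemma Sum_any_delta_0: "Sum_any (\<lambda>i::nat. if i = 0 then x else 0) = (x::'a::comm_monoid_add)"
  by (simp add: Sum_any.expand_superset[of "{0}"])

subsection \<open>Consequences of the Jacobi identity\<close>

context weak_module
begin

lemma mode_hom: "module_hom scaleW scaleW (YW v n)"
  using linear_mode by (simp add: linear_iff_module_hom)

lemma state_hom: "module_hom scaleV scaleW (\<lambda>v. YW v n x)"
  using linear_state by (simp add: linear_iff_module_hom)

lemmas mode_simps = module_hom.add[OF mode_hom] module_hom.diff[OF mode_hom]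
  module_hom.scale[OF mode_hom] module_hom.zero[OF mode_hom]
lemmas state_simps = module_hom.add[OF state_hom] module_hom.diff[OF state_hom]
  module_hom.scale[OF state_hom] module_hom.zero[OF state_hom]

lemma subspace_mode: "W.subspace S \<Longrightarrow> W.subspace {x. YW v n x \<in> S}"
  by (simp add: W.subspace_def mode_simps)

lemma subspace_state: "W.subspace S \<Longrightarrow> V.subspace {v. YW v n x \<in> S}"
  by (simp add: W.subspace_def V.subspace_def state_simps)

text \<open>The case \<open>l = 0\<close> of the Jacobi identity: \<open>0 gchoose i\<close> leaves
  only \<open>i = 0\<close> on the left. In the same way \<open>iterate\<close> is the case
  \<open>m = 0\<close>, where the right-hand side collapses.\<close>

lemma commutator:
  "YW u m (YW v n x) - YW v n (YW u m x) =
     Sum_any (\<lambda>i::nat. scaleW (of_int m gchoose i) (YW (Y u (int i) v) (m + n - int i) x))"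
proof -
  have 1: "scaleW ((-1) ^ i * (of_int 0 gchoose i)) (YW u (m + 0 - int i) (YW v (n + int i) x))
      = (if i = 0 then YW u m (YW v n x) else 0)" for i
    by (simp add: gbinomial_0_left)
  have 2: "scaleW ((-1) powi 0 * (-1) ^ i * (of_int 0 gchoose i))
       (YW v (n + 0 - int i) (YW u (m + int i) x))
      = (if i = 0 then YW v n (YW u m x) else 0)" for i
    by (simp add: gbinomial_0_left)
  from jacobi[of 0 u m v n x, unfolded 1 2 Sum_any_delta_0] show ?thesis by simp
qed

lemma commutator_mem:
  assumes "W.subspace S" "\<And>i. YW (Y u (int i) v) (m + n - int i) x \<in> S"
  shows "YW u m (YW v n x) - YW v n (YW u m x) \<in> S"
  unfolding commutator using assms by (intro W.subspace_Sum_any W.subspace_scale) auto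

lemma iterate:
  "YW (Y u l v) n x =
     Sum_any (\<lambda>i::nat. scaleW ((-1) ^ i * (of_int l gchoose i))
          (YW u (l - int i) (YW v (n + int i) x)))
     - Sum_any (\<lambda>i::nat. scaleW ((-1) powi l * (-1) ^ i * (of_int l gchoose i))
          (YW v (n + l - int i) (YW u (int i) x)))"
proof -
  have 1: "scaleW (of_int 0 gchoose i) (YW (Y u (l + int i) v) (0 + n - int i) x)
      = (if i = 0 then YW (Y u l v) n x else 0)" for i
    by (simp add: gbinomial_0_left)
  from jacobi[of l u 0 v n x, unfolded 1 Sum_any_delta_0] show ?thesis by simp
qed

lemma iterate_mem:
  assumes "W.subspace S"
    and "\<And>i::nat. YW u (l - int i) (YW v (n + int i) x) \<in> S"
    and "\<And>i::nat. YW v (n + l - int i) (YW u (int i) x) \<in> S"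
  shows "YW (Y u l v) n x \<in> S"
  unfolding iterate using assms
  by (intro W.subspace_diff W.subspace_Sum_any W.subspace_scale) auto

lemma truncation_finite: "finite {i::nat. YW v (n + int i) x \<noteq> 0}"
proof -
  obtain N where N: "\<forall>k\<ge>N. YW v k x = 0" using truncation by blast
  have "{i::nat. YW v (n + int i) x \<noteq> 0} \<subseteq> {..nat (N - n)}"
  proof
    fix i assume "i \<in> {i::nat. YW v (n + int i) x \<noteq> 0}"
    then have "\<not> N \<le> n + int i" using N by auto
    then show "i \<in> {..nat (N - n)}" by auto
  qed
  then show ?thesis by (rule finite_subset) simp
qed

text \<open>All factors \<open>(-1) ^ i * (-1 gchoose i)\<close> equal 1, and
  \<open>(-1) powi (-1)\<close> turns the difference into a sum.\<close>

lemma iterate_normal_ordered: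
  "YW (Y u (-1) v) n x =
     Sum_any (\<lambda>i::nat. YW u (-1 - int i) (YW v (n + int i) x))
     + Sum_any (\<lambda>i::nat. YW v (n - 1 - int i) (YW u (int i) x))"
proof -
  have c: "(-1) ^ i * (of_int (-1) gchoose i) = (1::complex)" for i
  proof -
    have "of_int (-1) gchoose i = (-1) ^ i * (of_nat i gchoose i :: complex)"
      using gbinomial_negated_upper[of "-1::complex" i] by simp
    then show ?thesis by (simp add: binomial_gbinomial[symmetric] flip: power_add)
  qed
  have 1: "scaleW ((-1) ^ i * (of_int (-1) gchoose i)) y = y" for i y
    unfolding c by simp
  have 2: "scaleW ((-1) powi (-1) * (-1) ^ i * (of_int (-1) gchoose i)) y = scaleW (-1) y" for i y
    unfolding mult.assoc c by (simp add: power_int_minus)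
  have neg: "Sum_any (\<lambda>i. - g i) = - Sum_any g" for g :: "nat \<Rightarrow> 'w"
    by (simp add: Sum_any.expand_set sum_negf)
  show ?thesis
    using iterate[of u "-1" v n x, unfolded 1 2] by (simp add: neg algebra_simps)
qed

text \<open>The two sums run over all pairs of indices with sum \<open>n - 1\<close>: the index of
  \<open>u\<close> is negative in the first and nonnegative in the second, where the order is
  reversed. By \<open>comm\<close> the order is irrelevant modulo \<open>S\<close>, so by
  \<open>main\<close> only the pair with index \<open>s\<close> of \<open>u\<close>
  survives.\<close>

lemma iterate_normal_ordered_mem:
  assumes S: "W.subspace S"
    and main: "\<And>i j. i + j = n - 1 \<Longrightarrow> i \<noteq> s \<Longrightarrow> YW u i (YW v j x) \<in> S"
    and comm: "\<And>i j. YW u i (YW v j x) - YW v j (YW u i x) \<in> S"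
  shows "YW (Y u (-1) v) n x - YW u s (YW v (n - 1 - s) x) \<in> S"
proof -
  let ?f = "\<lambda>i::nat. YW u (-1 - int i) (YW v (n + int i) x)"
  let ?g = "\<lambda>i::nat. YW v (n - 1 - int i) (YW u (int i) x)"
  have f: "?f i \<in> S" if "-1 - int i \<noteq> s" for i
    using that by (intro main) auto
  have g: "?g i \<in> S" if "int i \<noteq> s" for i
    using main[of "int i" "n - 1 - int i"] comm[of "int i" "n - 1 - int i"] that
      W.subspace_diff_mem[OF S] by auto
  have fin_f: "finite {i. ?f i \<noteq> 0}"
    by (rule finite_subset[OF _ truncation_finite[of v n x]]) (auto simp: mode_simps)
  have fin_g: "finite {i. ?g i \<noteq> 0}"
    by (rule finite_subset[OF _ truncation_finite[of u 0 x]]) (auto simp: mode_simps)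
  show ?thesis
  proof (cases "s < 0")
    case True
    define k where "k = nat (-1 - s)"
    have k: "int k = -1 - s" using True by (simp add: k_def)
    have "Sum_any ?f - ?f k \<in> S"
      by (rule W.subspace_Sum_any_diff[OF S fin_f f]) (use k in auto)
    moreover have "Sum_any ?g \<in> S"
      by (rule W.subspace_Sum_any[OF S g]) (use True in auto)
    ultimately have "(Sum_any ?f - ?f k) + Sum_any ?g \<in> S"
      by (rule W.subspace_add[OF S])
    then show ?thesis unfolding iterate_normal_ordered by (simp add: k algebra_simps)
  next
    case False
    define k where "k = nat s"
    have k: "int k = s" using False by (simp add: k_def)
    have "Sum_any ?g - ?g k \<in> S"
      by (rule W.subspace_Sum_any_diff[OF S fin_g g]) (use k in auto)
    moreover have "Sum_any ?f \<in> S"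
      by (rule W.subspace_Sum_any[OF S f]) (use False in auto)
    ultimately have "Sum_any ?f + (Sum_any ?g - ?g k) \<in> S"
      by (intro W.subspace_add[OF S])
    from W.subspace_diff[OF S this comm[of s "n - 1 - s"]]
    have "Sum_any ?f + Sum_any ?g - YW u s (YW v (n - 1 - s) x) \<in> S"
      using k by (simp add: algebra_simps)
    then show ?thesis unfolding iterate_normal_ordered by (simp add: algebra_simps)
  qed
qed

text \<open>The index \<open>-2\<close> is reached in one step: \<open>(u\<^sub>l 1)\<^bsub>-2\<^esub> = -l u\<^bsub>l-1\<^esub>\<close> for \<open>l < 0\<close>.\<close>

lemma mode_in_C2:
  assumes "n \<le> -2"
  shows "YW u n x \<in> C2 scaleW YW"
proof -
  define l where "l = n + 1"
  have l: "l \<le> -1" using assms by (simp add: l_def)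
  \<comment> \<open>The only nonzero mode of \<open>vac\<close> has index \<open>-1\<close>, which
    forces \<open>i = 1\<close> here; in the second sum the index is at most
    \<open>-3\<close>.\<close>
  have 1: "scaleW ((-1) ^ i * (of_int l gchoose i)) (YW u (l - int i) (YW vac (-2 + int i) x))
     = (if i = 1 then scaleW (- of_int l) (YW u n x) else 0)" for i
    by (auto simp: vacuum mode_simps l_def simp del: of_int_add)
  have 2: "scaleW ((-1) powi l * (-1) ^ i * (of_int l gchoose i))
          (YW vac (-2 + l - int i) (YW u (int i) x)) = 0" for i
    using l by (simp add: vacuum)
  have "YW (Y u l vac) (-2) x = scaleW (- of_int l) (YW u n x)"
    unfolding iterate 1 2
    by (simp add: Sum_any.expand_superset[of "{1}"])
  then have "YW u n x = scaleW (- (1 / of_int l)) (YW (Y u l vac) (-2) x)"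
    using l by simp
  moreover have "YW (Y u l vac) (-2) x \<in> C2 scaleW YW"
    unfolding C2_def by (rule W.span_base) blast
  ultimately show ?thesis
    unfolding C2_def using W.span_scale by metis
qed

end

subsection \<open>The weight grading\<close>

context cft_type_voa
begin

abbreviation weight :: "int \<Rightarrow> 'v set" where
  "weight \<equiv> weight_space scale Y \<omega>"

lemma subspace_weight: "V.subspace (weight d)"
  using grading by (auto simp: direct_sum_decomposition_def)

text \<open>Only two terms survive in the commutator of L(0) with the mode \<open>n\<close> of
  \<open>u\<close>: L(-1) contributes the factor \<open>-(n + 1)\<close> by
  \<open>translation\<close>, and L(0) contributes \<open>a\<close>.\<close>

lemma weight_mode:
  assumes u: "u \<in> weight a" and v: "v \<in> weight b"
  shows "Y u n v \<in> weight (a + b - n - 1)"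
proof -
  have b0: "(1::complex) gchoose i = 0" if "i \<notin> {0, 1}" for i
    using that binomial_gbinomial[of 1 i, where ?'a = complex] by (simp add: binomial_eq_0)
  have "Y \<omega> 1 (Y u n v) - Y u n (Y \<omega> 1 v) =
      (\<Sum>i\<in>{0, 1::nat}. scale (1 gchoose i) (Y (Y \<omega> (int i) u) (1 + n - int i) v))"
    unfolding commutator of_int_1
  proof (rule Sum_any.expand_superset)
    show "{i. scale (1 gchoose i) (Y (Y \<omega> (int i) u) (1 + n - int i) v) \<noteq> 0} \<subseteq> {0, 1}"
      using b0 by (metis (mono_tags, lifting) V.scale_zero_left mem_Collect_eq subsetI)
  qed simp
  also have "\<dots> = scale (of_int (a - n - 1)) (Y u n v)"
    using u by (simp add: weight_space_def translation state_simps algebra_simps)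
  finally have "Y \<omega> 1 (Y u n v) = scale (of_int (a - n - 1)) (Y u n v) + Y u n (Y \<omega> 1 v)"
    by (simp add: algebra_simps)
  then show ?thesis
    using v by (simp add: weight_space_def mode_simps flip: V.scale_left_distrib)
qed

text \<open>Components are indexed by all integers, so that uniqueness comes from
  \<open>grading\<close>, while \<open>nonneg_grading\<close> supplies a decomposition vanishing in
  negative degrees.\<close>

definition decomposes :: "(int \<Rightarrow> 'v) \<Rightarrow> 'v \<Rightarrow> bool" where
  "decomposes f v \<longleftrightarrow> (\<forall>d. f d \<in> weight d) \<and> finite {d. f d \<noteq> 0} \<and> v = Sum_any f"

lemma decomposes_unique: "decomposes f v \<Longrightarrow> decomposes g v \<Longrightarrow> f = g"
  using grading unfolding direct_sum_decomposition_def decomposes_def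
  by (metis UNIV_I)

lemma decomposes_obtain:
  obtains f where "decomposes f v" "\<And>d. d < 0 \<Longrightarrow> f d = 0"
proof -
  obtain f where f: "\<forall>i\<in>{0..}. f i \<in> weight i" "\<forall>i. i \<notin> {0..} \<longrightarrow> f i = 0"
    "finite {i. f i \<noteq> 0}" "v = Sum_any f"
    using nonneg_grading unfolding direct_sum_decomposition_def by metis
  have "f d \<in> weight d" for d
    using f(1,2) V.subspace_0[OF subspace_weight] by (cases "d \<ge> 0") auto
  then have "decomposes f v" unfolding decomposes_def using f(3,4) by blast
  with f(2) that show thesis by auto
qed

lemma decomposes_homogeneous:
  assumes "v \<in> weight d"
  shows "decomposes (\<lambda>i. if i = d then v else 0) v"
  using assms V.subspace_0[OF subspace_weight]
  by (auto simp: decomposes_def Sum_any.expand_superset[of "{d}"])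

lemma decomposes_add:
  assumes "decomposes f u" "decomposes g v"
  shows "decomposes (\<lambda>i. f i + g i) (u + v)"
proof -
  have "finite {i. f i + g i \<noteq> 0}"
    by (rule finite_subset[of _ "{i. f i \<noteq> 0} \<union> {i. g i \<noteq> 0}"])
      (use assms in \<open>auto simp: decomposes_def\<close>)
  with assms show ?thesis
    by (simp add: decomposes_def Sum_any.distrib V.subspace_add[OF subspace_weight])
qed

lemma decomposes_scale:
  assumes "decomposes f u"
  shows "decomposes (\<lambda>i. scale c (f i)) (scale c u)"
proof -
  have fin: "finite {i. f i \<noteq> 0}" using assms by (simp add: decomposes_def)
  have sub: "{i. scale c (f i) \<noteq> 0} \<subseteq> {i. f i \<noteq> 0}" by auto
  have "Sum_any (\<lambda>i. scale c (f i)) = (\<Sum>i | f i \<noteq> 0. scale c (f i))"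
    by (rule Sum_any.expand_superset[OF fin sub])
  also have "\<dots> = scale c (Sum_any f)"
    by (simp add: Sum_any.expand_set V.scale_sum_right)
  finally show ?thesis
    using assms finite_subset[OF sub fin]
    by (simp add: decomposes_def V.subspace_scale[OF subspace_weight])
qed

text \<open>By uniqueness, \<open>v\<close> placed in degree \<open>d\<close> agrees with a
  decomposition that vanishes in negative degrees.\<close>

lemma weight_negative:
  assumes "d < 0" "v \<in> weight d"
  shows "v = 0"
proof -
  obtain f where f: "decomposes f v" "\<And>d. d < 0 \<Longrightarrow> f d = 0"
    using decomposes_obtain by blast
  with decomposes_unique[OF f(1) decomposes_homogeneous[OF assms(2)]] assms(1)
  show ?thesis by (metis (full_types))
qed

lemma vac_weight: "vac \<in> weight 0"
  unfolding weight_zero by (simp add: V.span_base)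

lemma homogeneous_induct:
  assumes S: "V.subspace S" and hom: "\<And>d u. u \<in> weight (int d) \<Longrightarrow> u \<in> S"
  shows "v \<in> S"
proof -
  obtain f where f: "decomposes f v" "\<And>d. d < 0 \<Longrightarrow> f d = 0"
    using decomposes_obtain by blast
  have "f d \<in> S" for d
  proof (cases "d < 0")
    case True
    then show ?thesis using f(2) V.subspace_0[OF S] by simp
  next
    case False
    then show ?thesis using hom[of "f d" "nat d"] f(1) by (simp add: decomposes_def)
  qed
  then have "Sum_any f \<in> S" by (rule V.subspace_Sum_any[OF S])
  then show ?thesis using f(1) by (simp add: decomposes_def)
qed

text \<open>The degree \<open>d\<close> part of C2(V). Homogeneous generators are kept explicit so
  that \<open>high_letter_Fil\<close> can use the weights of their factors.\<close>

definition C2_weight :: "nat \<Rightarrow> 'v set" where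
  "C2_weight d = V.span {Y a (-2) b | a b i j.
     a \<in> weight (int i) \<and> b \<in> weight (int j) \<and> i + j + 1 = d}"

text \<open>The vectors whose components in degrees at least \<open>K\<close> lie in
  \<open>C2_weight\<close> form a subspace \<open>G K\<close>. It contains C2(V), and for large
  \<open>K\<close> also a finite set spanning V modulo C2(V), so it is then all of V.\<close>

lemma high_weight_in_C2:
  assumes "C2_cofinite scale Y"
  obtains K where "\<And>d. d \<ge> K \<Longrightarrow> weight (int d) \<subseteq> C2_weight d"
proof -
  define G where "G K = {v. \<exists>f. decomposes f v \<and> (\<forall>d\<ge>K. f (int d) \<in> C2_weight d)}" for K :: nat
  have sub_C2_weight: "V.subspace (C2_weight d)" for d
    by (simp add: C2_weight_def)
  have G: "V.subspace (G K)" for K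
  proof (rule V.subspaceI)
    have "decomposes (\<lambda>_. 0) 0"
      using decomposes_homogeneous[OF V.subspace_0[OF subspace_weight], of 0] by simp
    then show "0 \<in> G K"
      using V.subspace_0[OF sub_C2_weight] unfolding G_def by blast
    show "u + v \<in> G K" if uv: "u \<in> G K" "v \<in> G K" for u v
    proof -
      obtain f g where "decomposes f u" "\<forall>d\<ge>K. f (int d) \<in> C2_weight d"
        "decomposes g v" "\<forall>d\<ge>K. g (int d) \<in> C2_weight d"
        using uv unfolding G_def by blast
      then have "decomposes (\<lambda>i. f i + g i) (u + v)"
        "\<forall>d\<ge>K. f (int d) + g (int d) \<in> C2_weight d"
        by (auto intro: decomposes_add V.subspace_add[OF sub_C2_weight])
      then show ?thesis unfolding G_def by blast
    qed
    show "scale c u \<in> G K" if u: "u \<in> G K" for c u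
    proof -
      obtain f where "decomposes f u" "\<forall>d\<ge>K. f (int d) \<in> C2_weight d"
        using u unfolding G_def by blast
      then have "decomposes (\<lambda>i. scale c (f i)) (scale c u)"
        "\<forall>d\<ge>K. scale c (f (int d)) \<in> C2_weight d"
        by (auto intro: decomposes_scale V.subspace_scale[OF sub_C2_weight])
      then show ?thesis unfolding G_def by blast
    qed
  qed
  obtain B where B: "finite B" "coset (C2 scale Y) ` V.span B = range (coset (C2 scale Y))"
    using assms unfolding C2_cofinite_def finite_dim_quotient_def by blast
  have "\<exists>K. b \<in> G K" for b
  proof -
    obtain f where f: "decomposes f b"
      using decomposes_obtain by blast
    then have "finite {d. f d \<noteq> 0}" by (simp add: decomposes_def)
    then obtain k where k: "\<forall>d\<in>{d. f d \<noteq> 0}. d \<le> k"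
      by (metis bdd_above_finite bdd_above_def)
    then have "\<forall>d\<ge>nat (k + 1). f (int d) = 0"
      by force
    then show ?thesis using f V.subspace_0[OF sub_C2_weight] unfolding G_def
      by (intro exI[of _ "nat (k + 1)"] CollectI exI[of _ f]) auto
  qed
  then obtain k where k: "\<And>b. b \<in> G (k b)" by metis
  define K where "K = Max (insert 0 (k ` B))"
  have mono: "G i \<subseteq> G j" if "i \<le> j" for i j
    using that by (force simp: G_def)
  have "B \<subseteq> G K"
    using B(1) k mono[of "k _" K] by (force simp: K_def)
  then have span_B: "V.span B \<subseteq> G K"
    by (rule V.span_minimal[OF _ G])
  have hom: "Y a (-2) b \<in> G K" if "a \<in> weight (int i)" "b \<in> weight (int j)" for a b i j
  proof -
    have "Y a (-2) b \<in> weight (int (i + j + 1))"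
      using weight_mode[OF that, of "-2"] by (simp add: algebra_simps)
    moreover have "Y a (-2) b \<in> C2_weight (i + j + 1)"
      unfolding C2_weight_def using that by (intro V.span_base) blast
    ultimately show ?thesis
      using decomposes_homogeneous[of "Y a (-2) b" "int (i + j + 1)"]
        V.subspace_0[OF sub_C2_weight] unfolding G_def
      by (intro CollectI exI[of _ "\<lambda>k. if k = int (i + j + 1) then Y a (-2) b else 0"])
        (auto simp del: of_nat_add of_nat_Suc)
  qed
  have "Y a (-2) b \<in> G K" if "a \<in> weight (int i)" for a b i
    using homogeneous_induct[OF subspace_mode[OF G], of a "-2" K b] hom[OF that] by simp
  then have "Y a (-2) b \<in> G K" for a b
    using homogeneous_induct[OF subspace_state[OF G], of "-2" b K a] by simp
  then have C2: "C2 scale Y \<subseteq> G K"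
    unfolding C2_def by (intro V.span_minimal[OF _ G]) blast
  have all: "v \<in> G K" for v
  proof -
    obtain b where b: "b \<in> V.span B" "coset (C2 scale Y) v = coset (C2 scale Y) b"
      using B(2) by (metis imageE rangeI)
    have "v \<in> coset (C2 scale Y) v"
      using V.span_zero by (force simp: coset_def C2_def)
    then obtain c where "c \<in> C2 scale Y" "v = b + c"
      unfolding b(2) by (auto simp: coset_def)
    then show ?thesis using b(1) span_B C2 V.subspace_add[OF G] by blast
  qed
  show thesis
  proof (rule that[of K], rule subsetI)
    fix d v assume d: "K \<le> d" and v: "v \<in> weight (int d)"
    obtain f where f: "decomposes f v" "\<forall>d\<ge>K. f (int d) \<in> C2_weight d"
      using all[of v] by (auto simp: G_def)
    have "f (int d) = v"
      using decomposes_unique[OF f(1) decomposes_homogeneous[OF v]] by simp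
    then show "v \<in> C2_weight d" using f(2) d by auto
  qed
qed

end

subsection \<open>The weight filtration of a cyclic module\<close>

text \<open>Irreducibility enters only through the fact that a nonzero vector generates the module,
  so the argument is carried out for a module with one generator.\<close>

locale cyclic_weak_module =
  cft_type_voa scale Y vac \<omega> + M: weak_module scale scaleW Y vac YW
  for scale :: "complex \<Rightarrow> 'v::ab_group_add \<Rightarrow> 'v" and Y vac \<omega>
    and scaleW :: "complex \<Rightarrow> 'w::ab_group_add \<Rightarrow> 'w" and YW +
  fixes gen :: 'w
  assumes generated: "M.W.subspace U \<Longrightarrow> gen \<in> U \<Longrightarrow> (\<And>v n x. x \<in> U \<Longrightarrow> YW v n x \<in> U) \<Longrightarrow> U = UNIV"
begin

text \<open>A letter \<open>(d, u, n)\<close> stands for the mode \<open>u\<^sub>n\<close> of a vector \<open>u\<close> of weight \<open>d\<close>. The total weight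
  of a word ignores the mode indices.\<close>

primrec act :: "(nat \<times> 'v \<times> int) list \<Rightarrow> 'w" where
  "act [] = gen"
| "act (l # ls) = YW (fst (snd l)) (snd (snd l)) (act ls)"

definition word :: "(nat \<times> 'v \<times> int) list \<Rightarrow> bool" where
  "word ls \<longleftrightarrow> (\<forall>(d, u, n)\<in>set ls. u \<in> weight (int d))"

abbreviation wt :: "(nat \<times> 'v \<times> int) list \<Rightarrow> nat" where
  "wt ls \<equiv> sum_list (map fst ls)"

text \<open>The strict inequality makes \<open>Fil (wt ls)\<close> the space of lower-order terms
  relative to \<open>act ls\<close>.\<close>

definition Fil :: "nat \<Rightarrow> 'w set" where
  "Fil p = M.W.span {act ls | ls. word ls \<and> wt ls < p}"

lemma word_simps [simp]:
  "word []" "word ((d, u, n) # ls) \<longleftrightarrow> u \<in> weight (int d) \<and> word ls"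
  "word (ls @ ks) \<longleftrightarrow> word ls \<and> word ks"
  by (simp_all add: word_def ball_Un)

lemma word_mset: "mset ls = mset ks \<Longrightarrow> word ls \<longleftrightarrow> word ks"
  unfolding word_def by (metis mset_eq_setD)

lemma wt_mset: "mset ls = mset ks \<Longrightarrow> wt ls = wt ks"
  by (metis mset_map sum_mset_sum_list)

lemma subspace_Fil: "M.W.subspace (Fil p)"
  by (simp add: Fil_def)

lemma act_in_Fil: "word ls \<Longrightarrow> wt ls < p \<Longrightarrow> act ls \<in> Fil p"
  unfolding Fil_def by (rule M.W.span_base) blast

lemma Fil_mode:
  assumes u: "u \<in> weight (int d)" and x: "x \<in> Fil p"
  shows "YW u n x \<in> Fil (d + p)"
proof -
  have "x \<in> {x. YW u n x \<in> Fil (d + p)}"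
    using x unfolding Fil_def
  proof (rule M.W.span_minimalI)
    show "M.W.subspace {x. YW u n x \<in> M.W.span {act ls |ls. word ls \<and> wt ls < d + p}}"
      by (intro M.subspace_mode) simp
    show "a \<in> {x. YW u n x \<in> M.W.span {act ls |ls. word ls \<and> wt ls < d + p}}"
      if "a \<in> {act ls |ls. word ls \<and> wt ls < p}" for a
      using that act_in_Fil[of "(d, u, n) # _" "d + p"] u by (auto simp: Fil_def)
  qed
  then show ?thesis by simp
qed

text \<open>For \<open>i \<ge> 0\<close> the vector \<open>Y u i v\<close> has weight
  \<open>a + b - i - 1\<close>, below \<open>a + b\<close>, and it is 0 if this number is
  negative.\<close>

lemma commutator_Fil:
  assumes u: "u \<in> weight (int a)" and v: "v \<in> weight (int b)" and ls: "word ls"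
  shows "YW u m (YW v n (act ls)) - YW v n (YW u m (act ls)) \<in> Fil (a + b + wt ls)"
proof (rule M.commutator_mem[OF subspace_Fil])
  fix i :: nat
  have w: "Y u (int i) v \<in> weight (int a + int b - int i - 1)"
    by (rule weight_mode[OF u v])
  show "YW (Y u (int i) v) (m + n - int i) (act ls) \<in> Fil (a + b + wt ls)"
  proof (cases "a + b < i + 1")
    case True
    then have "Y u (int i) v = 0" using weight_negative[OF _ w] by simp
    then show ?thesis by (simp add: M.state_simps M.W.subspace_0[OF subspace_Fil])
  next
    case False
    define d where "d = a + b - i - 1"
    have "int d = int a + int b - int i - 1" using False by (simp add: d_def)
    with w ls have "word ((d, Y u (int i) v, m + n - int i) # ls)" by simp
    from act_in_Fil[OF this, of "a + b + wt ls"] False show ?thesis by (simp add: d_def)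
  qed
qed

lemma act_move:
  assumes "word (l # ls @ ks)"
  shows "act (ls @ l # ks) - act (l # ls @ ks) \<in> Fil (wt (l # ls @ ks))"
  using assms
proof (induction ls)
  case Nil
  then show ?case by (simp add: M.W.subspace_0[OF subspace_Fil])
next
  case (Cons k ls)
  obtain d u n where l: "l = (d, u, n)" by (cases l) auto
  obtain e v m where k: "k = (e, v, m)" by (cases k) auto
  have IH: "act (ls @ l # ks) - act (l # ls @ ks) \<in> Fil (wt (l # ls @ ks))"
    using Cons by (simp add: l k)
  have v: "v \<in> weight (int e)" and u: "u \<in> weight (int d)" and w: "word (ls @ ks)"
    using Cons.prems by (auto simp: l k)
  have "YW v m (act (ls @ l # ks) - act (l # ls @ ks)) \<in> Fil (e + wt (l # ls @ ks))"
    by (rule Fil_mode[OF v IH])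
  moreover have "YW v m (YW u n (act (ls @ ks))) - YW u n (YW v m (act (ls @ ks)))
      \<in> Fil (e + d + wt (ls @ ks))"
    by (rule commutator_Fil[OF v u w])
  ultimately have "YW v m (act (ls @ l # ks) - act (l # ls @ ks)) +
     (YW v m (YW u n (act (ls @ ks))) - YW u n (YW v m (act (ls @ ks))))
      \<in> Fil (wt (l # (k # ls) @ ks))"
    by (intro M.W.subspace_add[OF subspace_Fil]) (simp_all add: l k algebra_simps)
  then show ?case by (simp add: l k M.mode_simps)
qed

text \<open>By \<open>act_move\<close> the head of \<open>ls\<close> can be brought to the front of
  \<open>ks\<close>; then the tails are compared by induction. Later proofs use this to bring a
  chosen letter to the front or to the end.\<close>

lemma act_mset:
  assumes "word ls" "mset ls = mset ks"
  shows "act ls - act ks \<in> Fil (wt ls)"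
  using assms
proof (induction ls arbitrary: ks)
  case Nil
  then show ?case by (simp add: M.W.subspace_0[OF subspace_Fil])
next
  case (Cons l ls)
  from Cons.prems(2) have "l \<in> set ks" by (metis list.set_intros(1) mset_eq_setD)
  then obtain xs ys where ks: "ks = xs @ l # ys" by (meson split_list)
  have ms: "mset ls = mset (xs @ ys)" using Cons.prems(2) ks by simp
  obtain d u n where l: "l = (d, u, n)" by (cases l) auto
  have w: "word ls" "u \<in> weight (int d)" using Cons.prems(1) by (auto simp: l)
  have w': "word (l # xs @ ys)"
    using word_mset[OF ms] w by (simp add: l)
  have 1: "YW u n (act ls - act (xs @ ys)) \<in> Fil (d + wt ls)"
    by (rule Fil_mode[OF w(2) Cons.IH[OF w(1) ms]])
  have 2: "act (xs @ l # ys) - act (l # xs @ ys) \<in> Fil (wt (l # xs @ ys))"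
    by (rule act_move[OF w'])
  have wt: "d + wt ls = wt (l # ls)" "wt (l # xs @ ys) = wt (l # ls)"
    using wt_mset[OF ms] by (simp_all add: l)
  from M.W.subspace_diff[OF subspace_Fil 1[unfolded wt] 2[unfolded wt]]
  have "YW u n (act ls) - act ks \<in> Fil (wt (l # ls))"
    by (simp add: ks l M.mode_simps)
  then show ?case by (simp add: l)
qed

text \<open>The factors of a generator of \<open>C2_weight d\<close> have total weight
  \<open>d - 1\<close>, and \<open>iterate\<close> expands its modes into two-letter products of
  modes of these factors.\<close>

lemma high_letter_Fil:
  assumes K: "weight (int d) \<subseteq> C2_weight d" and u: "u \<in> weight (int d)" and ls: "word ls"
  shows "YW u n (act ls) \<in> Fil (d + wt ls)"
proof -
  have "u \<in> {u. YW u n (act ls) \<in> Fil (d + wt ls)}"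
  proof (rule V.span_minimalI)
    show "u \<in> V.span {Y a (-2) b | a b i j.
      a \<in> weight (int i) \<and> b \<in> weight (int j) \<and> i + j + 1 = d}"
      using K u by (auto simp: C2_weight_def)
    show "V.subspace {u. YW u n (act ls) \<in> Fil (d + wt ls)}"
      by (rule M.subspace_state[OF subspace_Fil])
    fix x assume "x \<in> {Y a (-2) b | a b i j.
      a \<in> weight (int i) \<and> b \<in> weight (int j) \<and> i + j + 1 = d}"
    then obtain a b i j where x: "x = Y a (-2) b" and a: "a \<in> weight (int i)"
      and b: "b \<in> weight (int j)" and d: "i + j + 1 = d" by blast
    have "YW (Y a (-2) b) n (act ls) \<in> Fil (d + wt ls)"
    proof (rule M.iterate_mem[OF subspace_Fil])
      fix k :: nat
      show "YW a (-2 - int k) (YW b (n + int k) (act ls)) \<in> Fil (d + wt ls)"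
        using act_in_Fil[of "(i, a, -2 - int k) # (j, b, n + int k) # ls" "d + wt ls"] a b ls d
        by simp
      show "YW b (n + -2 - int k) (YW a (int k) (act ls)) \<in> Fil (d + wt ls)"
        using act_in_Fil[of "(j, b, n + -2 - int k) # (i, a, int k) # ls" "d + wt ls"] a b ls d
        by simp
    qed
    then show "x \<in> {u. YW u n (act ls) \<in> Fil (d + wt ls)}" by (simp add: x)
  qed
  then show ?thesis by simp
qed

text \<open>Weight 0 consists of the multiples of \<open>vac\<close>, whose modes are 0 or the
  identity. Thus a letter of weight 0 can be deleted up to a scalar.\<close>

lemma weight_zero_mode:
  assumes "word ls" "u \<in> weight 0"
  shows "\<exists>c. YW u n (act ls) = scaleW c (act ls)"
proof -
  obtain c where u: "u = scale c vac"
    using assms(2) unfolding weight_zero by (auto simp: V.span_singleton)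
  show ?thesis
    by (cases "n = -1") (auto simp: u M.state_simps M.vacuum intro: exI[of _ c] exI[of _ 0])
qed

section \<open>Blocks of letters with a common index, obtained from a single mode\<close>

definition has_low :: "int \<Rightarrow> (nat \<times> 'v \<times> int) list \<Rightarrow> bool" where
  "has_low s ls \<longleftrightarrow> (\<exists>(d, u, n)\<in>set ls. 1 \<le> d \<and> n < s)"

text \<open>The errors allowed when a block of weight \<open>q\<close> in front of \<open>ks\<close>
  is rewritten: the first kind gains a letter of small index, the second loses weight.\<close>

definition low_span :: "int \<Rightarrow> nat \<Rightarrow> (nat \<times> 'v \<times> int) list \<Rightarrow> 'w set" where
  "low_span s q ks = M.W.span
     ({act (ls @ ks) | ls. word ls \<and> wt ls = q \<and> has_low s ls} \<union>
      {act ls | ls. word ls \<and> wt ls < q + wt ks})"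

lemma subspace_low_span: "M.W.subspace (low_span s q ks)"
  by (simp add: low_span_def)

lemma act_in_low_span:
  "word ls \<Longrightarrow> wt ls = q \<Longrightarrow> has_low s ls \<Longrightarrow> act (ls @ ks) \<in> low_span s q ks"
  unfolding low_span_def by (rule M.W.span_base) blast

lemma Fil_low_span: "Fil (q + wt ks) \<subseteq> low_span s q ks"
  unfolding low_span_def Fil_def by (rule M.W.span_mono) auto

lemma low_span_mode:
  assumes a: "a \<in> weight (int d)" and x: "x \<in> low_span s q ks"
  shows "YW a n x \<in> low_span s (d + q) ks"
proof -
  have "x \<in> {x. YW a n x \<in> low_span s (d + q) ks}"
  proof (rule M.W.span_minimalI[OF x[unfolded low_span_def]])
    show "M.W.subspace {x. YW a n x \<in> low_span s (d + q) ks}"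
      by (rule M.subspace_mode[OF subspace_low_span])
    fix y assume "y \<in> {act (ls @ ks) | ls. word ls \<and> wt ls = q \<and> has_low s ls} \<union>
      {act ls | ls. word ls \<and> wt ls < q + wt ks}"
    then show "y \<in> {x. YW a n x \<in> low_span s (d + q) ks}"
    proof
      assume "y \<in> {act (ls @ ks) | ls. word ls \<and> wt ls = q \<and> has_low s ls}"
      then obtain ls where "y = act (ls @ ks)" "word ls" "wt ls = q" "has_low s ls" by blast
      then show ?thesis
        using act_in_low_span[of "(d, a, n) # ls" "d + q" s ks] a by (auto simp: has_low_def)
    next
      assume "y \<in> {act ls | ls. word ls \<and> wt ls < q + wt ks}"
      then obtain ls where "y = act ls" "word ls" "wt ls < q + wt ks" by blast
      then have "YW a n y \<in> Fil (d + q + wt ks)"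
        using act_in_Fil[of "(d, a, n) # ls" "d + q + wt ks"] a by simp
      then show ?thesis using Fil_low_span[of "d + q" ks s] by blast
    qed
  qed
  then show ?thesis by simp
qed

text \<open>The index \<open>-1\<close> makes weights add up, so \<open>K\<close> letters of
  positive weight merge to a vector of weight at least \<open>K\<close>.\<close>

primrec merge :: "(nat \<times> 'v) list \<Rightarrow> 'v" where
  "merge [] = vac"
| "merge (l # ls) = Y (snd l) (-1) (merge ls)"

lemma merge_weight:
  "\<forall>(d, u)\<in>set us. u \<in> weight (int d) \<Longrightarrow> merge us \<in> weight (int (sum_list (map fst us)))"
proof (induction us)
  case Nil
  then show ?case by (simp add: vac_weight)
next
  case (Cons l us)
  then have "snd l \<in> weight (int (fst l))" by auto
  from weight_mode[OF this Cons.IH, of "-1"] Cons.prems show ?case by (simp add: algebra_simps)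
qed

text \<open>The index \<open>m\<close> is the one at which \<open>a\<^sup>1\<^sub>s \<dots> a\<^sup>r\<^sub>s\<close> occurs in the expansion of the mode of the merged
  vector: each \<open>(-1)\<close>-product satisfies \<open>(a\<^bsub>-1\<^esub>b)\<^sub>m \<equiv> \<Sum>\<^bsub>i+j=m-1\<^esub> a\<^sub>i b\<^sub>j\<close>, hence \<open>m = r s + r - 1\<close>. The induction
  needs in addition that all terms at smaller indices contain a letter with index below \<open>s\<close>.\<close>

lemma merge_expand:
  fixes s :: int
  assumes ks: "word ks" and us: "\<forall>(d, u)\<in>set us. 1 \<le> d \<and> u \<in> weight (int d)"
  defines "q \<equiv> sum_list (map fst us)"
  defines "m \<equiv> int (length us) * (s + 1) - 1"
  shows "YW (merge us) m (act ks) - act (map (\<lambda>(d, u). (d, u, s)) us @ ks) \<in> low_span s q ks"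
proof -
  have "(\<forall>j<m. YW (merge us) j (act ks) \<in> low_span s q ks) \<and>
    YW (merge us) m (act ks) - act (map (\<lambda>(d, u). (d, u, s)) us @ ks) \<in> low_span s q ks"
    using us unfolding q_def m_def
  proof (induction us)
    case Nil
    \<comment> \<open>Here \<open>m = -1\<close>, where \<open>vac\<close> acts as the identity; at
      smaller indices its modes vanish.\<close>
    then show ?case by (simp add: M.vacuum M.W.subspace_0[OF subspace_low_span])
  next
    case (Cons l us)
    obtain d a where l: "l = (d, a)" by (cases l) auto
    define b where "b = merge us"
    define q where "q = sum_list (map fst us)"
    define m where "m = int (length us) * (s + 1) - 1"
    define ws where "ws = map (\<lambda>(d, u). (d, u, s)) us"
    have us: "\<forall>(d, u)\<in>set us. u \<in> weight (int d)" and a: "a \<in> weight (int d)" "1 \<le> d"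
      using Cons.prems by (auto simp: l)
    have b: "b \<in> weight (int q)"
      unfolding b_def q_def by (rule merge_weight[OF us])
    have IH: "\<And>j. j < m \<Longrightarrow> YW b j (act ks) \<in> low_span s q ks"
      "YW b m (act ks) - act (ws @ ks) \<in> low_span s q ks"
      using Cons by (auto simp: b_def q_def m_def ws_def)
    let ?S = "low_span s (d + q) ks"
    have comm: "YW a i (YW b j (act ks)) - YW b j (YW a i (act ks)) \<in> ?S" for i j
      using commutator_Fil[OF a(1) b ks] Fil_low_span by blast
    \<comment> \<open>For \<open>i < s\<close> the pair is itself a word with a low letter,
      \<open>b\<close> being one letter of weight \<open>q\<close>; for \<open>j < m\<close> the
      induction hypothesis applies.\<close>
    have low: "YW a i (YW b j (act ks)) \<in> ?S" if "i < s \<or> j < m" for i j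
      using that
    proof
      assume "i < s"
      then show ?thesis
        using act_in_low_span[of "[(d, a, i), (q, b, j)]" "d + q" s ks] a b
        by (auto simp: has_low_def)
    next
      assume "j < m"
      from low_span_mode[OF a(1) IH(1)[OF this]] show ?thesis .
    qed
    \<comment> \<open>The two indices sum to at most \<open>m + s\<close>, so if the first is not
      \<open>s\<close>, then it is below \<open>s\<close> or the second is below
      \<open>m\<close>.\<close>
    have expand: "YW (Y a (-1) b) j (act ks) - YW a i (YW b (j - 1 - i) (act ks)) \<in> ?S"
      if "j \<le> m + s + 1" "i = s" for i j
      by (rule M.iterate_normal_ordered_mem[OF subspace_low_span _ comm], rule low)
        (use that in linarith)
    \<comment> \<open>Here even the pair with first index \<open>s\<close> has second index below
      \<open>m\<close>.\<close>
    have 1: "YW (Y a (-1) b) j (act ks) \<in> ?S" if "j < m + s + 1" for j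
      using M.W.subspace_diff_mem[OF subspace_low_span expand[of j s]] low[of s "j - 1 - s"] that
      by auto
    have "YW a s (YW b m (act ks) - act (ws @ ks)) \<in> ?S"
      by (rule low_span_mode[OF a(1) IH(2)])
    then have 2: "YW (Y a (-1) b) (m + s + 1) (act ks) - YW a s (act (ws @ ks)) \<in> ?S"
      using M.W.subspace_add[OF subspace_low_span expand[of "m + s + 1" s],
          of "YW a s (YW b m (act ks) - act (ws @ ks))"]
      by (simp add: M.mode_simps)
    have m': "int (length (l # us)) * (s + 1) - 1 = m + s + 1"
      by (simp add: m_def algebra_simps)
    show ?case
      unfolding m' using 1 2 by (simp add: l b_def q_def ws_def)
  qed
  then show ?thesis by blast
qed

section \<open>Long words modulo C2(W)\<close>

definition C2_Fil :: "nat \<Rightarrow> 'w set" where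
  "C2_Fil p = M.W.span (C2 scaleW YW \<union> Fil p)"

lemma subspace_C2_Fil: "M.W.subspace (C2_Fil p)"
  by (simp add: C2_Fil_def)

lemma Fil_C2_Fil: "Fil p \<subseteq> C2_Fil p" and C2_C2_Fil: "C2 scaleW YW \<subseteq> C2_Fil p"
  unfolding C2_Fil_def using M.W.span_superset by blast+

lemma act_C2_Fil_mset:
  assumes "word ls" "mset ls = mset ks"
  shows "act ls \<in> C2_Fil (wt ls) \<longleftrightarrow> act ks \<in> C2_Fil (wt ls)"
  using act_mset[OF assms] Fil_C2_Fil M.W.subspace_diff_mem[OF subspace_C2_Fil] by blast

text \<open>Letters of weight 0 are left out, since the total weight of a block must be at least its
  length.\<close>

definition count_low :: "int \<Rightarrow> (nat \<times> 'v \<times> int) list \<Rightarrow> nat" where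
  "count_low s ls = length (filter (\<lambda>(d, u, n). 1 \<le> d \<and> n \<le> s) ls)"

definition count_eq :: "int \<Rightarrow> (nat \<times> 'v \<times> int) list \<Rightarrow> nat" where
  "count_eq s ls = length (filter (\<lambda>(d, u, n). 1 \<le> d \<and> n = s) ls)"

lemma count_append:
  "count_low s (ls @ ks) = count_low s ls + count_low s ks"
  "count_eq s (ls @ ks) = count_eq s ls + count_eq s ks"
  by (simp_all add: count_low_def count_eq_def)

lemma count_low_Suc: "count_low (s + 1) ls = count_low s ls + count_eq (s + 1) ls"
  by (induction ls) (auto simp: count_low_def count_eq_def)

lemma has_low_count: "has_low (s + 1) ls \<Longrightarrow> 1 \<le> count_low s ls"
  by (force simp: has_low_def count_low_def Suc_le_eq filter_empty_conv)

lemma low_mode_C2_Fil: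
  assumes w: "word ls" and l: "(d, u, n) \<in> set ls" "n \<le> -2"
  shows "act ls \<in> C2_Fil (wt ls)"
proof -
  obtain xs ys where ls: "ls = xs @ (d, u, n) # ys" using l(1) by (meson split_list)
  have "act ((d, u, n) # xs @ ys) \<in> C2_Fil (wt ls)"
    using M.mode_in_C2[OF l(2)] C2_C2_Fil by auto
  then show ?thesis using act_C2_Fil_mset[OF w, of "(d, u, n) # xs @ ys"] by (simp add: ls)
qed

text \<open>Each block of \<open>K\<close> letters with index \<open>s + 1\<close> is traded for at least one letter with index at most
  \<open>s\<close>.\<close>

lemma block_C2_Fil:
  assumes K: "\<And>d. d \<ge> K \<Longrightarrow> weight (int d) \<subseteq> C2_weight d"
    and N: "\<And>ls. word ls \<Longrightarrow> N \<le> count_low s ls \<Longrightarrow> act ls \<in> C2_Fil (wt ls)"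
  shows "word ls \<Longrightarrow> N \<le> count_low s ls + t \<Longrightarrow> t * K \<le> count_eq (s + 1) ls \<Longrightarrow> act ls \<in> C2_Fil (wt ls)"
proof (induction t arbitrary: ls)
  case 0
  then show ?case by (simp add: N)
next
  \<comment> \<open>\<open>t\<close> bounds the number of low letters missing from \<open>N\<close>,
    and one block is spent on each. The word is split into a block \<open>bs\<close> of
    \<open>K\<close> letters with index \<open>s + 1\<close> and the rest \<open>ks\<close>.\<close>
  case (Suc t)
  let ?P = "\<lambda>(d, u :: 'v, n). 1 \<le> (d::nat) \<and> n = s + 1"
  define us where "us = map (\<lambda>(d, u, n). (d, u)) (take K (filter ?P ls))"
  define bs where "bs = map (\<lambda>(d, u). (d, u, s + 1)) us"
  define ks where "ks = drop K (filter ?P ls) @ filter (\<lambda>l. \<not> ?P l) ls"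
  have bs: "bs = take K (filter ?P ls)"
    unfolding bs_def us_def map_map
    by (rule map_idI) (auto dest!: in_set_takeD)
  have perm: "mset ls = mset (bs @ ks)"
  proof -
    have "mset ls = mset (filter ?P ls) + mset (filter (\<lambda>l. \<not> ?P l) ls)" by simp
    also have "mset (filter ?P ls) = mset (take K (filter ?P ls)) + mset (drop K (filter ?P ls))"
      by (metis append_take_drop_id mset_append)
    finally show ?thesis unfolding bs ks_def mset_append add.assoc .
  qed
  have w: "word bs" "word ks" using word_mset[OF perm] Suc.prems(1) by auto
  have wt: "wt ls = wt bs + wt ks" using wt_mset[OF perm] by simp
  have len: "length us = K"
    using Suc.prems(3) by (simp add: us_def count_eq_def)
  have us: "\<forall>(d, u)\<in>set us. 1 \<le> d \<and> u \<in> weight (int d)"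
  proof -
    have "1 \<le> fst y \<and> snd y \<in> weight (int (fst y))" if y: "y \<in> set us" for y
    proof -
      obtain x where x: "y = (case x of (d, u, n) \<Rightarrow> (d, u))" "x \<in> set (take K (filter ?P ls))"
        using y unfolding us_def set_map by (rule imageE)
      then show ?thesis
        using in_set_takeD[OF x(2)] Suc.prems(1) by (auto simp: word_def)
    qed
    then show ?thesis by auto
  qed
  define q where "q = sum_list (map fst us)"
  have q: "wt bs = q" by (simp add: bs_def q_def o_def case_prod_beta)
  have "K \<le> q"
  proof -
    have "length us \<le> sum_list (map fst us)"
      using us by (induction us) auto
    then show ?thesis by (simp add: len q_def)
  qed
  have count: "count_low s ks = count_low s ls" "t * K \<le> count_eq (s + 1) ks"
  proof -
    have "count_low s (bs @ ks) = count_low s ls" "count_eq (s + 1) (bs @ ks) = count_eq (s + 1) ls"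
      using perm unfolding count_low_def count_eq_def by (metis mset_filter size_mset)+
    moreover have "count_low s bs = 0" "count_eq (s + 1) bs \<le> K"
      using len by (auto simp: bs_def count_low_def count_eq_def filter_empty_conv
          intro: order_trans[OF length_filter_le])
    ultimately show "count_low s ks = count_low s ls" "t * K \<le> count_eq (s + 1) ks"
      using Suc.prems(3) by (auto simp: count_append)
  qed
  \<comment> \<open>An error word of full weight has a new letter of index at most \<open>s\<close>,
    while \<open>ks\<close> keeps all the old ones and enough letters for \<open>t\<close> further
    blocks, so the induction hypothesis applies.\<close>
  have low: "low_span (s + 1) q ks \<subseteq> C2_Fil (wt ls)"
    unfolding low_span_def
  proof (rule M.W.span_minimal[OF _ subspace_C2_Fil], rule Un_least)
    show "{act (xs @ ks) | xs. word xs \<and> wt xs = q \<and> has_low (s + 1) xs} \<subseteq> C2_Fil (wt ls)"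
    proof clarify
      fix xs assume xs: "word xs" "q = wt xs" "has_low (s + 1) xs"
      have "act (xs @ ks) \<in> C2_Fil (wt (xs @ ks))"
      proof (rule Suc.IH)
        show "word (xs @ ks)" using xs(1) w(2) by simp
        show "N \<le> count_low s (xs @ ks) + t"
          using Suc.prems(2) has_low_count[OF xs(3)] by (simp add: count_append count(1))
        show "t * K \<le> count_eq (s + 1) (xs @ ks)"
          using count(2) by (simp add: count_append)
      qed
      then show "act (xs @ ks) \<in> C2_Fil (wt ls)" by (simp add: wt q xs(2))
    qed
    show "{act ls | ls. word ls \<and> wt ls < q + wt ks} \<subseteq> C2_Fil (wt ls)"
      using Fil_C2_Fil[of "wt ls"] by (auto simp: wt q intro!: act_in_Fil)
  qed
  let ?m = "int (length us) * (s + 1 + 1) - 1"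
  have "YW (merge us) ?m (act ks) - act (bs @ ks) \<in> C2_Fil (wt ls)"
    using merge_expand[OF w(2) us, of "s + 1"] low unfolding bs_def q_def by blast
  \<comment> \<open>The merged vector has weight \<open>q \<ge> K\<close>, so its mode yields only
    lower-order terms.\<close>
  moreover have "YW (merge us) ?m (act ks) \<in> Fil (q + wt ks)"
    using us by (intro high_letter_Fil[OF K[OF \<open>K \<le> q\<close>] _ w(2)])
      (auto simp: q_def intro!: merge_weight)
  then have "YW (merge us) ?m (act ks) \<in> C2_Fil (wt ls)"
    using Fil_C2_Fil by (auto simp: wt q)
  ultimately have "act (bs @ ks) \<in> C2_Fil (wt ls)"
    using M.W.subspace_diff_mem[OF subspace_C2_Fil] by blast
  then show ?case using act_C2_Fil_mset[OF Suc.prems(1) perm] by simp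
qed

lemma long_words_C2_Fil:
  assumes K: "\<And>d. d \<ge> K \<Longrightarrow> weight (int d) \<subseteq> C2_weight d" and s: "-2 \<le> s"
  shows "\<exists>N. \<forall>ls. word ls \<and> N \<le> count_low s ls \<longrightarrow> act ls \<in> C2_Fil (wt ls)"
  using s
proof (induction s rule: int_ge_induct)
  case base
  have "act ls \<in> C2_Fil (wt ls)" if w: "word ls" and c: "1 \<le> count_low (-2) ls" for ls
  proof -
    obtain d u n where "(d, u, n) \<in> set ls" "n \<le> -2"
      using c by (force simp: count_low_def Suc_le_eq filter_empty_conv)
    then show ?thesis by (rule low_mode_C2_Fil[OF w])
  qed
  then show ?case by blast
next
  case (step s)
  then obtain N where N: "\<And>ls. word ls \<Longrightarrow> N \<le> count_low s ls \<Longrightarrow> act ls \<in> C2_Fil (wt ls)"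
    by blast
  \<comment> \<open>If fewer than \<open>N\<close> letters have index at most \<open>s\<close>, then
    at least \<open>N * K\<close> have index \<open>s + 1\<close>: enough blocks for
    \<open>t = N\<close>.\<close>
  have "act ls \<in> C2_Fil (wt ls)" if w: "word ls" and c: "N + N * K \<le> count_low (s + 1) ls" for ls
  proof (cases "N \<le> count_low s ls")
    case True
    then show ?thesis by (rule N[OF w])
  next
    case False
    then have eq: "N * K \<le> count_eq (s + 1) ls" using c by (simp add: count_low_Suc)
    show ?thesis
      by (rule block_C2_Fil[where K = K and N = N and t = N, OF _ _ w _ eq]) (simp_all add: K N)
  qed
  then show ?case by blast
qed

section \<open>A finite spanning set modulo C2(W)\<close>

lemma span_words: "M.W.span {act ls | ls. word ls} = UNIV" (is "?S = _")
proof (rule generated)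
  show "M.W.subspace ?S" by simp
  show "gen \<in> ?S"
    by (rule M.W.span_base) (auto intro!: exI[of _ "[]"])
  fix v n x assume x: "x \<in> ?S"
  have hom: "YW u n x \<in> ?S" if u: "u \<in> weight (int d)" for u d
  proof -
    have "x \<in> {x. YW u n x \<in> ?S}"
    proof (rule M.W.span_minimalI[OF x M.subspace_mode])
      show "M.W.subspace ?S" by simp
      fix y assume "y \<in> {act ls | ls. word ls}"
      then obtain ls where "y = act ls" "word ls" by blast
      with u have "YW u n y = act ((d, u, n) # ls)" "word ((d, u, n) # ls)" by simp_all
      then show "y \<in> {x. YW u n x \<in> ?S}"
        using M.W.span_base[of "YW u n y" "{act ls | ls. word ls}"] by blast
    qed
    then show ?thesis by simp
  qed
  have "v \<in> {v. YW v n x \<in> ?S}"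
    by (rule homogeneous_induct[OF M.subspace_state]) (use hom in auto)
  then show "YW v n x \<in> ?S" by simp
qed

lemma act_append_annihilated: "YW u n gen = 0 \<Longrightarrow> act (ls @ [(d, u, n)]) = 0"
  by (induction ls) (simp_all add: M.mode_simps)

text \<open>Bounds on weights, indices and length can still leave infinitely many words. Letters
  from a finite set give finitely many vectors, and multilinearity reaches the rest.\<close>

primrec words_over :: "('v \<times> int) set \<Rightarrow> nat \<Rightarrow> 'w set" where
  "words_over A 0 = {gen}"
| "words_over A (Suc k) = (\<lambda>((b, n), x). YW b n x) ` (A \<times> words_over A k)"

lemma finite_words_over: "finite A \<Longrightarrow> finite (words_over A k)"
  by (induction k) simp_all

lemma act_in_span_words_over:
  assumes "\<forall>(d, u, n)\<in>set ls. u \<in> V.span B \<and> n \<in> I"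
  shows "act ls \<in> M.W.span (words_over (B \<times> I) (length ls))"
  using assms
proof (induction ls)
  case Nil
  then show ?case by (simp add: M.W.span_base)
next
  case (Cons l ls)
  obtain d u n where l: "l = (d, u, n)" by (cases l) auto
  let ?S = "M.W.span (words_over (B \<times> I) (length (l # ls)))"
  have n: "n \<in> I" and u: "u \<in> V.span B" using Cons.prems by (auto simp: l)
  have "act ls \<in> M.W.span (words_over (B \<times> I) (length ls))"
    using Cons by simp
  then have b: "act ls \<in> {x. YW b n x \<in> ?S}" if b: "b \<in> B" for b
  proof (rule M.W.span_minimalI)
    show "M.W.subspace {x. YW b n x \<in> ?S}" by (intro M.subspace_mode) simp
    fix y assume "y \<in> words_over (B \<times> I) (length ls)"
    then have "YW b n y \<in> words_over (B \<times> I) (length (l # ls))"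
      using b n by force
    then show "y \<in> {x. YW b n x \<in> ?S}" by (simp only: mem_Collect_eq M.W.span_base)
  qed
  have "u \<in> {u. YW u n (act ls) \<in> ?S}"
  proof (rule V.span_minimalI[OF u])
    show "V.subspace {u. YW u n (act ls) \<in> ?S}" by (intro M.subspace_state) simp
  qed (use b in blast)
  then show ?case by (simp add: l)
qed

lemma C2_cofinite_module:
  assumes "C2_cofinite scale Y"
  shows "C2_cofinite scaleW YW"
proof -
  obtain K where K: "\<And>d. d \<ge> K \<Longrightarrow> weight (int d) \<subseteq> C2_weight d"
    using high_weight_in_C2[OF assms] by blast
  have "\<forall>d. \<exists>B. finite B \<and> V.span B = weight d"
    using grading_finite_dim by (simp add: finite_dim_def)
  then obtain B0 where B0: "\<And>d. finite (B0 d)" "\<And>d. V.span (B0 d) = weight d"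
    by metis
  define B where "B = (\<Union>d<K. B0 (int d))"
  have finB: "finite B" by (simp add: B_def B0)
  have span_B: "weight (int d) \<subseteq> V.span B" if "d < K" for d
    unfolding B0(2)[symmetric] B_def using that by (intro V.span_mono) auto
  have "\<forall>v. \<exists>N. \<forall>n\<ge>N. YW v n gen = 0"
    using M.truncation by blast
  from choice[OF this] obtain t where t: "\<And>v n. n \<ge> t v \<Longrightarrow> YW v n gen = 0"
    by blast
  \<comment> \<open>One truncation bound serves all letters of weight below \<open>K\<close>, since
    they lie in the span of the finite set \<open>B\<close>. Inserting 0 ensures
    \<open>-2 \<le> T\<close>, as \<open>long_words_C2_Fil\<close> requires.\<close>
  define T where "T = Max (insert 0 (t ` B))"
  have tT: "t b \<le> T" if "b \<in> B" for b
    unfolding T_def using finB that by (intro Max_ge) auto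
  have T: "YW u n gen = 0" if "u \<in> weight (int d)" "d < K" "T \<le> n" for u d n
  proof -
    have "u \<in> {u. YW u n gen \<in> {0}}"
    proof (rule V.span_minimalI)
      show "u \<in> V.span B" using span_B that by blast
      show "V.subspace {u. YW u n gen \<in> {0}}" by (rule M.subspace_state) simp
      show "b \<in> {u. YW u n gen \<in> {0}}" if "b \<in> B" for b
        using t[of b n] tT[OF that] \<open>T \<le> n\<close> by simp
    qed
    then show ?thesis by simp
  qed
  have "0 \<le> T"
    unfolding T_def using finB by (intro Max_ge) auto
  then have "-2 \<le> T" by simp
  then obtain N where N: "\<And>ls. word ls \<Longrightarrow> N \<le> count_low T ls \<Longrightarrow> act ls \<in> C2_Fil (wt ls)"
    using long_words_C2_Fil[OF K] by blast
  define E where "E = (\<Union>k<N. words_over (B \<times> {-1..<T}) k)"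
  have finE: "finite E" by (simp add: E_def finB finite_words_over)
  define Q where "Q = M.W.span (C2 scaleW YW \<union> E)"
  have Q: "M.W.subspace Q" by (simp add: Q_def)
  \<comment> \<open>The outer induction on total weight absorbs lower-order terms; the inner one on
    length allows letters of weight 0 to be deleted.\<close>
  have "act ls \<in> Q" if "word ls" "wt ls = p" for ls p
    using that
  proof (induction p arbitrary: ls rule: less_induct)
    case (less p)
    have Fil_Q: "Fil p \<subseteq> Q"
      unfolding Fil_def using less.IH by (intro M.W.span_minimal[OF _ Q]) blast
    have "C2 scaleW YW \<subseteq> Q"
      unfolding Q_def using M.W.span_superset by blast
    with Fil_Q have C2_Fil_Q: "C2_Fil p \<subseteq> Q"
      unfolding C2_Fil_def by (intro M.W.span_minimal[OF _ Q]) blast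
    show ?case
      using less.prems
    proof (induction "length ls" arbitrary: ls rule: less_induct)
      case (less ls)
      note w = less.prems(1) and p = less.prems(2)
      have perm: "act ls \<in> Q \<longleftrightarrow> act ks \<in> Q" if "mset ls = mset ks" for ks
        using act_mset[OF w that] Fil_Q p M.W.subspace_diff_mem[OF Q] by blast
      consider (high) d u n where "(d, u, n) \<in> set ls" "K \<le> d"
        | (vac) u n where "(0, u, n) \<in> set ls"
        | (neg) d u n where "(d, u, n) \<in> set ls" "n \<le> -2"
        | (big) d u n where "(d, u, n) \<in> set ls" "d < K" "T \<le> n"
        | (good) "\<forall>(d, u, n)\<in>set ls. 1 \<le> d \<and> d < K \<and> -1 \<le> n \<and> n < T"
      proof (cases "\<forall>(d, u, n)\<in>set ls. 1 \<le> d \<and> d < K \<and> -1 \<le> n \<and> n < T")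
        case True
        then show thesis by (rule good)
      next
        case False
        then obtain d u n where l: "(d, u, n) \<in> set ls"
          and "\<not> (1 \<le> d \<and> d < K \<and> -1 \<le> n \<and> n < T)" by auto
        then consider "K \<le> d" | "d = 0" | "n \<le> -2" | "d < K" "T \<le> n" by linarith
        then show thesis by cases (use l high vac neg big in blast)+
      qed
      then show ?case
      proof cases
        case high
        then obtain xs ys where ls: "ls = xs @ (d, u, n) # ys" by (meson split_list)
        have "act ((d, u, n) # xs @ ys) \<in> Fil p"
          using high_letter_Fil[OF K[OF high(2)], of u "xs @ ys" n] w p by (simp add: ls algebra_simps)
        then show ?thesis using perm[of "(d, u, n) # xs @ ys"] Fil_Q by (auto simp: ls)
      next
        case vac
        then obtain xs ys where ls: "ls = xs @ (0, u, n) # ys" by (meson split_list)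
        have "act (xs @ ys) \<in> Q"
          using w p by (intro less.hyps) (simp_all add: ls)
        moreover obtain c where "YW u n (act (xs @ ys)) = scaleW c (act (xs @ ys))"
          using weight_zero_mode[of "xs @ ys" u n] w by (auto simp: ls)
        ultimately have "act ((0, u, n) # xs @ ys) \<in> Q"
          using M.W.subspace_scale[OF Q] by simp
        then show ?thesis using perm[of "(0, u, n) # xs @ ys"] by (simp add: ls)
      next
        case neg
        then show ?thesis using low_mode_C2_Fil[OF w] C2_Fil_Q p by blast
      next
        case big
        then obtain xs ys where ls: "ls = xs @ (d, u, n) # ys" by (meson split_list)
        \<comment> \<open>Placed last, the letter acts directly on \<open>gen\<close>.\<close>
        have "act ((xs @ ys) @ [(d, u, n)]) = 0"
          using w by (intro act_append_annihilated T[OF _ big(2,3)]) (simp add: ls)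
        then show ?thesis
          using perm[of "(xs @ ys) @ [(d, u, n)]"] M.W.subspace_0[OF Q] by (simp add: ls)
      next
        case good
        show ?thesis
        proof (cases "N \<le> length ls")
          case True
          \<comment> \<open>Every letter is counted by \<open>count_low T\<close>, so the bound
            \<open>N\<close> applies to the length itself.\<close>
          have "filter (\<lambda>(d, u, n). 1 \<le> d \<and> n \<le> T) ls = ls"
            using good by (auto simp: filter_id_conv)
          then show ?thesis using N[OF w] True C2_Fil_Q p by (auto simp: count_low_def)
        next
          case False
          have "\<forall>(d, u, n)\<in>set ls. u \<in> V.span B \<and> n \<in> {-1..<T}"
          proof
            fix x assume x: "x \<in> set ls"
            obtain d u n where l: "x = (d, u, n)" by (cases x) auto
            show "case x of (d, u, n) \<Rightarrow> u \<in> V.span B \<and> n \<in> {-1..<T}"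
              using bspec[OF good x] bspec[OF w[unfolded word_def] x] span_B[of d] by (auto simp: l)
          qed
          then have "act ls \<in> M.W.span (words_over (B \<times> {-1..<T}) (length ls))"
            by (rule act_in_span_words_over)
          also have "\<dots> \<subseteq> Q"
            unfolding Q_def E_def using False by (intro M.W.span_mono) auto
          finally show ?thesis .
        qed
      qed
    qed
  qed
  then have "M.W.span {act ls | ls. word ls} \<subseteq> Q"
    by (intro M.W.span_minimal[OF _ Q]) blast
  then have all: "x \<in> Q" for x
    by (auto simp: span_words)
  have C2: "M.W.subspace (C2 scaleW YW)"
    by (simp add: C2_def)
  have "coset (C2 scaleW YW) x \<in> coset (C2 scaleW YW) ` M.W.span E" for x
  proof -
    obtain a b where a: "a \<in> M.W.span (C2 scaleW YW)" and b: "b \<in> M.W.span E" and x: "x = a + b"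
      using all[of x] unfolding Q_def by (rule M.W.span_Un_obtain)
    have a: "a \<in> C2 scaleW YW"
      using a C2 by (metis M.W.span_eq_iff)
    have "coset (C2 scaleW YW) x = coset (C2 scaleW YW) b"
    proof (intro set_eqI iffI)
      fix y assume "y \<in> coset (C2 scaleW YW) x"
      then obtain u where "u \<in> C2 scaleW YW" "y = b + (a + u)"
        by (auto simp: coset_def x algebra_simps)
      then show "y \<in> coset (C2 scaleW YW) b"
        using M.W.subspace_add[OF C2 a] by (auto simp: coset_def)
    next
      fix y assume "y \<in> coset (C2 scaleW YW) b"
      then obtain u where "u \<in> C2 scaleW YW" "y = x + (u - a)"
        by (auto simp: coset_def x)
      then show "y \<in> coset (C2 scaleW YW) x"
        using M.W.subspace_diff[OF C2 _ a] by (auto simp: coset_def)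
    qed
    then show ?thesis using b by blast
  qed
  then have "coset (C2 scaleW YW) ` M.W.span E = range (coset (C2 scaleW YW))"
    by blast
  then show ?thesis
    unfolding C2_cofinite_def finite_dim_quotient_def using finE by blast
qed

end

theorem proposition5p2:
  fixes scaleV :: "complex \<Rightarrow> 'v::ab_group_add \<Rightarrow> 'v"
    and Y :: "'v \<Rightarrow> int \<Rightarrow> 'v \<Rightarrow> 'v"
    and vac \<omega> :: 'v
    and scaleW :: "complex \<Rightarrow> 'w::ab_group_add \<Rightarrow> 'w"
    and YW :: "'v \<Rightarrow> int \<Rightarrow> 'w \<Rightarrow> 'w"
  assumes "cft_type_voa scaleV Y vac \<omega>"
    and "C2_cofinite scaleV Y"
    and "irreducible_weak_module scaleV scaleW Y vac YW"
  shows "C2_cofinite scaleW YW"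
proof -
  interpret V: cft_type_voa scaleV Y vac \<omega> by fact
  interpret W: irreducible_weak_module scaleV scaleW Y vac YW by fact
  obtain w :: 'w where w: "w \<noteq> 0"
    using W.nontrivial by auto
  interpret cyclic_weak_module scaleV Y vac \<omega> scaleW YW w
  proof
    fix U assume "module.subspace scaleW U" "w \<in> U" "\<And>v n x. x \<in> U \<Longrightarrow> YW v n x \<in> U"
    then show "U = UNIV" using W.irreducible[of U] w by blast
  qed
  show ?thesis by (rule C2_cofinite_module) fact
qed

end
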